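(* Let $n,c,r\in\mathbb{N}$, let $d\ge 2$ be a finite integer, let $q_1,\ldots,q_n\in(0,1)$, and set $q_{j,k}=(1-d^{k-1-c})q_j$ for $1\le j\le n$, $1\le k\le c$; write $\mathbf{Q}=(q_{j,k})$. Let $X_{j,k}\sim\mathrm{Geo}(q_{j,k})$ be independent over all $j,k$, let $Y_j^{(c)}=\sum_{k=1}^c X_{j,k}$, and $Y_{n:n}^{(c)}=\max_{1\le j\le n}Y_j^{(c)}$. Let $\tilde X_{j,k}$ be independent exponential random variables with rates $\phi(q_{j,k})=-\log(1-q_{j,k})$, $\tilde Y_j^{(c)}=\sum_{k=1}^c\tilde X_{j,k}$ (hypo-exponential), and $\tilde Y_{n:n}^{(c)}=\max_{1\le j\le n}\tilde Y_j^{(c)}$. Then $$\Psi_r(\mathbf{Q})\le\mathbb{E}\bigl[(Y_{n:n}^{(c)})^r\bigr]\le\sum_{s=0}^{r}\binom{r}{s}\Psi_s(\mathbf{Q})\,c^{r-s},$$ where $\Psi_s(\mathbf{Q})=\mathbb{E}[(\tilde Y_{n:n}^{(c)})^s]$ for integers $s\ge 0$ (so $\Psi_0=1$), and for $s\ge1$ $$\Psi_s(\mathbf{Q})=\int_0^\infty\Bigl(1-\prod_{j=1}^{n}F_{\tilde Y_j^{(c)}}\bigl(y^{1/s}\bigr)\Bigr)\,dy,$$ with $F_{\tilde Y_j^{(c)}}$ the cumulative distribution function of $\tilde Y_j^{(c)}$.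
   Context: $\mathbb{N}=\{1,2,\ldots\}$. $\mathrm{Geo}(q)$ is the geometric distribution on $\{1,2,\ldots\}$ with $\mathbb{P}(X=k)=(1-q)^{k-1}q$. Interpretation: $Y_{n:n}^{(c)}$ is the number of time slots until all $n$ receivers, connected by independent erasure channels with reception probabilities $q_j$, decode a block of $c$ packets when random linear combinations over a field of size $d$ are broadcast. *)

theory Defs
  imports "HOL-Probability.Probability"
begin

text \<open>The library's \<open>geometric_pmf\<close> is supported on $\{0, 1, \ldots\}$;
  here the support is $\{1, 2, \ldots\}$.\<close>

definition Geo :: "real \<Rightarrow> nat pmf"
  where "Geo p = map_pmf Suc (geometric_pmf p)"

lemma pmf_Geo:
  assumes "0 < p" "p \<le> 1" "k \<ge> 1"
  shows "pmf (Geo p) k = (1 - p) ^ (k - 1) * p"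
  using assms by (cases k) (simp_all add: Geo_def pmf_map_inj')

definition \<phi> :: "real \<Rightarrow> real"
  where "\<phi> p = - ln (1 - p)"

text \<open>The exponent $k - 1 - c$ is a negative integer for $1 \le k \le c$.\<close>

definition rlc_prob :: "nat \<Rightarrow> nat \<Rightarrow> (nat \<Rightarrow> real) \<Rightarrow> nat \<Rightarrow> nat \<Rightarrow> real"
  where "rlc_prob d c q j k = (1 - real d powi (int k - 1 - int c)) * q j"

text \<open>The two functions below are applied both to the integer-valued geometric and to the
  real-valued exponential variables.\<close>

definition decode_time ::
    "nat \<Rightarrow> (nat \<Rightarrow> nat \<Rightarrow> 'a \<Rightarrow> 'b::comm_monoid_add) \<Rightarrow> nat \<Rightarrow> 'a \<Rightarrow> 'b"
  where "decode_time c X j \<omega> = (\<Sum>k=1..c. X j k \<omega>)"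

definition max_decode_time ::
    "nat \<Rightarrow> nat \<Rightarrow> (nat \<Rightarrow> nat \<Rightarrow> 'a \<Rightarrow> 'b::{comm_monoid_add, linorder}) \<Rightarrow> 'a \<Rightarrow> 'b"
  where "max_decode_time n c X \<omega> = Max ((\<lambda>j. decode_time c X j \<omega>) ` {1..n})"

definition \<Psi> ::
    "'b measure \<Rightarrow> nat \<Rightarrow> nat \<Rightarrow> (nat \<Rightarrow> nat \<Rightarrow> 'b \<Rightarrow> real) \<Rightarrow> nat \<Rightarrow> real"
  where "\<Psi> N n c Z s = prob_space.expectation N (\<lambda>\<omega>. max_decode_time n c Z \<omega> ^ s)"

end

theory Submission
  imports Defs
begin

text \<open>If \<open>Z\<close> is exponential with rate \<open>- ln (1 - p)\<close>, then \<open>\<lceil>Z\<rceil>\<close> is geometric with parameter \<open>p\<close> on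
  \<open>{1, 2, \<dots>}\<close>. Rounding up all the exponential variables therefore reproduces the joint law of the
  geometric ones, so both maxima can be compared pointwise on one probability space:
  since \<open>Z \<le> \<lceil>Z\<rceil> \<le> Z + 1\<close>, a sum of \<open>c\<close> terms, and hence the maximum over the receivers,
  grows by at most \<open>c\<close>. Taking powers and expanding \<open>(V + c)\<^sup>r\<close> gives the two bounds. The integral
  formula is the layer-cake formula combined with the independence of the receivers.\<close>

subsection \<open>Rounding up exponential variables\<close>

text \<open>The rate is chosen so that \<open>exp (- \<phi> p) = 1 - p\<close>, hence
  \<open>Z \<le> k\<close> has probability \<open>1 - (1 - p) ^ k\<close> at every natural
  \<open>k\<close>. The ceiling equals \<open>m + 1\<close> exactly when
  \<open>m < Z \<le> m + 1\<close>, so its point masses are differences of consecutive values, and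
  point masses determine a law on a countable set.\<close>

lemma (in prob_space) distr_ceiling_exponential:
  assumes D: "distributed M lborel Z (exponential_density (\<phi> p))" and p: "0 < p" "p < 1"
  shows "distr M (count_space UNIV) (\<lambda>\<omega>. nat \<lceil>Z \<omega>\<rceil>) = measure_pmf (Geo p)"
proof (rule measure_eqI_countable[of _ UNIV])
  have pos: "0 < \<phi> p"
    using p by (simp add: \<phi>_def)
  have [measurable]: "Z \<in> borel_measurable M"
    using distributed_measurable[OF D] by simp
  have exp_\<phi>: "exp (- (real k * \<phi> p)) = (1 - p) ^ k" for k
    using p by (simp add: \<phi>_def exp_of_nat_mult)
  have cdf: "prob {\<omega> \<in> space M. Z \<omega> \<le> real k} = 1 - (1 - p) ^ k" for k
    using exponential_distributedD_le[OF D _ pos, of "real k"] exp_\<phi>[of k] by simp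
  fix k :: nat
  have "prob {\<omega> \<in> space M. nat \<lceil>Z \<omega>\<rceil> = k} = pmf (Geo p) k"
  proof (cases k)
    case 0
    \<comment> \<open>\<open>nat\<close> sends negative ceilings to 0, so the value 0 collects all
      of \<open>Z \<le> 0\<close>. This event is null, matching the support of \<open>Geo\<close>,
      which starts at 1.\<close>
    have "prob {\<omega> \<in> space M. nat \<lceil>Z \<omega>\<rceil> = 0} = prob {\<omega> \<in> space M. Z \<omega> \<le> real 0}"
      by (intro arg_cong[where f = prob]) (auto simp: nat_eq_iff2 ceiling_le_iff)
    also have "\<dots> = 0"
      unfolding cdf by simp
    also have "\<dots> = pmf (Geo p) 0"
      by (auto simp: Geo_def pmf_eq_0_set_pmf)
    finally show ?thesis
      using 0 by simp
  next
    case (Suc m)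
    have "prob {\<omega> \<in> space M. nat \<lceil>Z \<omega>\<rceil> = k} =
        prob ({\<omega> \<in> space M. Z \<omega> \<le> real (Suc m)} - {\<omega> \<in> space M. Z \<omega> \<le> real m})"
      unfolding Suc by (intro arg_cong[where f = prob]) (auto simp: nat_eq_iff ceiling_eq_iff)
    also have "\<dots> = prob {\<omega> \<in> space M. Z \<omega> \<le> real (Suc m)} - prob {\<omega> \<in> space M. Z \<omega> \<le> real m}"
      by (intro finite_measure_Diff) auto
    also have "\<dots> = (1 - p) ^ m * p"
      unfolding cdf by (simp add: algebra_simps)
    finally show ?thesis
      using p Suc by (simp add: pmf_Geo)
  qed
  moreover have "(\<lambda>\<omega>. nat \<lceil>Z \<omega>\<rceil>) -` {k} \<inter> space M = {\<omega> \<in> space M. nat \<lceil>Z \<omega>\<rceil> = k}"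
    by auto
  ultimately show "emeasure (distr M (count_space UNIV) (\<lambda>\<omega>. nat \<lceil>Z \<omega>\<rceil>)) {k} =
      emeasure (measure_pmf (Geo p)) {k}"
    by (simp add: emeasure_distr emeasure_eq_measure emeasure_pmf_single)
qed auto

text \<open>Under independence the marginals determine the joint law. For a finite index set and
  countable values the product sigma-algebra is the discrete one, so the law is put on a
  \<open>count_space\<close>, where every function of the tuple is measurable.\<close>

lemma distr_joint_eq_PiM:
  assumes "prob_space M" "finite I" "I \<noteq> {}"
    and "prob_space.indep_vars M (\<lambda>_. count_space UNIV) X I"
    and "\<And>i. i \<in> I \<Longrightarrow> distr M (count_space UNIV) (X i) = L i"
  shows "distr M (count_space (I \<rightarrow>\<^sub>E (UNIV :: 'b :: countable set))) (\<lambda>\<omega>. \<lambda>i\<in>I. X i \<omega>) = PiM I L"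
proof -
  interpret prob_space M by fact
  have "distr M (PiM I (\<lambda>_. count_space (UNIV :: 'b set))) (\<lambda>\<omega>. \<lambda>i\<in>I. X i \<omega>) =
      PiM I (\<lambda>i. distr M (count_space UNIV) (X i))"
    using assms(3,4) by (subst indep_vars_iff_distr_eq_PiM'[symmetric]) (auto simp: indep_vars_def)
  also have "\<dots> = PiM I L"
    using assms(5) by (intro PiM_cong) auto
  finally show ?thesis
    using assms(2) by (simp add: count_space_PiM_finite)
qed

subsection \<open>The decoding time\<close>

lemma max_decode_time_leI:
  assumes "n \<ge> 1" "\<And>j. j \<in> {1..n} \<Longrightarrow> decode_time c X j \<omega> \<le> b"
  shows "max_decode_time n c X \<omega> \<le> b"
  using assms by (auto simp: max_decode_time_def)

lemma decode_time_le_max: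
  assumes "j \<in> {1..n}"
  shows "decode_time c X j \<omega> \<le> max_decode_time n c X \<omega>"
  using assms by (auto simp: max_decode_time_def)

lemma max_decode_time_le_iff:
  assumes "n \<ge> 1"
  shows "max_decode_time n c X \<omega> \<le> b \<longleftrightarrow> (\<forall>j\<in>{1..n}. decode_time c X j \<omega> \<le> b)"
  using assms by (auto simp: max_decode_time_def)

lemma max_decode_time_cong:
  assumes "\<And>j k. j \<in> {1..n} \<Longrightarrow> k \<in> {1..c} \<Longrightarrow> X j k \<omega> = Y j k \<omega>'"
  shows "max_decode_time n c X \<omega> = max_decode_time n c Y \<omega>'"
  unfolding max_decode_time_def decode_time_def using assms
  by (intro arg_cong[where f = Max] image_cong sum.cong) auto

lemma real_max_decode_time:
  assumes "n \<ge> 1"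
  shows "real (max_decode_time n c W \<omega>) = max_decode_time n c (\<lambda>j k \<omega>. real (W j k \<omega>)) \<omega>"
proof -
  have "real (Max ((\<lambda>j. decode_time c W j \<omega>) ` {1..n})) =
      Max (real ` (\<lambda>j. decode_time c W j \<omega>) ` {1..n})"
    using assms by (intro mono_Max_commute) (auto simp: mono_def)
  then show ?thesis
    by (simp add: max_decode_time_def decode_time_def image_image)
qed

text \<open>Each receiver adds up \<open>c\<close> terms, so a slack of \<open>a\<close> per term
  becomes \<open>c * a\<close>; the maximum over receivers adds nothing further. The case
  \<open>a = 0\<close> gives the lower comparison with the rounded variables, \<open>a = 1\<close>
  the upper one.\<close>

lemma max_decode_time_mono:
  fixes X Y :: "nat \<Rightarrow> nat \<Rightarrow> 'a \<Rightarrow> real"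
  assumes "n \<ge> 1" "\<And>j k. j \<in> {1..n} \<Longrightarrow> k \<in> {1..c} \<Longrightarrow> X j k \<omega> \<le> Y j k \<omega> + a"
  shows "max_decode_time n c X \<omega> \<le> max_decode_time n c Y \<omega> + real c * a"
proof (rule max_decode_time_leI)
  fix j assume j: "j \<in> {1..n}"
  have "decode_time c X j \<omega> \<le> (\<Sum>k=1..c. Y j k \<omega> + a)"
    unfolding decode_time_def using assms(2) j by (intro sum_mono) auto
  also have "\<dots> = decode_time c Y j \<omega> + real c * a"
    by (simp add: decode_time_def sum.distrib)
  also have "\<dots> \<le> max_decode_time n c Y \<omega> + real c * a"
    using decode_time_le_max[OF j] by simp
  finally show "decode_time c X j \<omega> \<le> max_decode_time n c Y \<omega> + real c * a" .
qed fact

lemma max_decode_time_nonneg: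
  fixes Z :: "nat \<Rightarrow> nat \<Rightarrow> 'a \<Rightarrow> real"
  assumes "n \<ge> 1" "\<And>j k. j \<in> {1..n} \<Longrightarrow> k \<in> {1..c} \<Longrightarrow> 0 \<le> Z j k \<omega>"
  shows "0 \<le> max_decode_time n c Z \<omega>"
proof -
  have "0 \<le> decode_time c Z 1 \<omega>"
    unfolding decode_time_def using assms by (intro sum_nonneg) auto
  also have "\<dots> \<le> max_decode_time n c Z \<omega>"
    using assms by (intro decode_time_le_max) auto
  finally show ?thesis .
qed

text \<open>A crude domination that reduces integrability of the powers of the maximum to moments of
  single entries: if \<open>B\<close> is the largest entry, every row sum is at most
  \<open>c * B\<close>, and \<open>B ^ s\<close> is one of the nonnegative summands on the
  right.\<close>

lemma max_decode_time_power_le: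
  fixes Z :: "nat \<Rightarrow> nat \<Rightarrow> 'a \<Rightarrow> real"
  assumes "n \<ge> 1" "c \<ge> 1" and nonneg: "\<And>j k. j \<in> {1..n} \<Longrightarrow> k \<in> {1..c} \<Longrightarrow> 0 \<le> Z j k \<omega>"
  shows "max_decode_time n c Z \<omega> ^ s \<le> real c ^ s * (\<Sum>(j, k)\<in>{1..n} \<times> {1..c}. Z j k \<omega> ^ s)"
proof -
  let ?I = "{1..n} \<times> {1..c}"
  define B where "B = Max ((\<lambda>(j, k). Z j k \<omega>) ` ?I)"
  have fin: "finite ((\<lambda>(j, k). Z j k \<omega>) ` ?I)" "(\<lambda>(j, k). Z j k \<omega>) ` ?I \<noteq> {}"
    using assms by auto
  obtain j k where jk: "(j, k) \<in> ?I" "B = Z j k \<omega>"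
    using Max_in[OF fin] unfolding B_def by auto
  have le_B: "Z j k \<omega> \<le> B" if "j \<in> {1..n}" "k \<in> {1..c}" for j k
    unfolding B_def using that fin by (intro Max_ge) auto
  have "max_decode_time n c Z \<omega> \<le> real c * B"
  proof (rule max_decode_time_leI)
    fix j assume j: "j \<in> {1..n}"
    show "decode_time c Z j \<omega> \<le> real c * B"
      unfolding decode_time_def using sum_bounded_above[of "{1..c}" "\<lambda>k. Z j k \<omega>" B] le_B j by auto
  qed fact
  then have "max_decode_time n c Z \<omega> ^ s \<le> (real c * B) ^ s"
    using max_decode_time_nonneg[where Z = Z, OF assms(1) nonneg] by (intro power_mono)
  also have "\<dots> = real c ^ s * Z j k \<omega> ^ s"
    by (simp add: jk power_mult_distrib)
  also have "Z j k \<omega> ^ s \<le> (\<Sum>(j, k)\<in>?I. Z j k \<omega> ^ s)"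
    using member_le_sum[of "(j, k)" ?I "\<lambda>(j, k). Z j k \<omega> ^ s"] jk nonneg by auto
  finally show ?thesis
    by (simp add: mult_left_mono)
qed

text \<open>Different receivers use the disjoint index blocks \<open>{j} \<times> {1..c}\<close>,
  and measurable functions of disjoint blocks of independent variables are independent.\<close>

lemma (in prob_space) indep_vars_decode_time:
  fixes Z :: "nat \<Rightarrow> nat \<Rightarrow> 'a \<Rightarrow> real"
  assumes "indep_vars (\<lambda>_. borel) (\<lambda>(j, k). Z j k) (J \<times> {1..c})"
  shows "indep_vars (\<lambda>_. borel) (decode_time c Z) J"
proof -
  have "indep_vars (\<lambda>j. PiM ({j} \<times> {1..c}) (\<lambda>_. borel))
      (\<lambda>j \<omega>. restrict (\<lambda>i. (case i of (j, k) \<Rightarrow> Z j k) \<omega>) ({j} \<times> {1..c})) J"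
    by (rule indep_vars_restrict[OF assms]) (auto simp: disjoint_family_on_def)
  then have "indep_vars (\<lambda>_. borel)
      (\<lambda>j \<omega>. \<Sum>k=1..c. restrict (\<lambda>i. (case i of (j, k) \<Rightarrow> Z j k) \<omega>) ({j} \<times> {1..c}) (j, k)) J"
    by (rule indep_vars_compose2[where Y = "\<lambda>j x. \<Sum>k=1..c. x (j, k)"]) simp
  also have "(\<lambda>j \<omega>. \<Sum>k=1..c. restrict (\<lambda>i. (case i of (j, k) \<Rightarrow> Z j k) \<omega>) ({j} \<times> {1..c}) (j, k)) =
      decode_time c Z"
    by (intro ext) (auto simp: decode_time_def intro!: sum.cong)
  finally show ?thesis .
qed

text \<open>The maximum is at most \<open>t\<close> iff every receiver's time is, so independence
  turns the probability into a product of distribution functions; the strict event is its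
  complement.\<close>

lemma (in prob_space) prob_max_decode_time_gt:
  fixes Z :: "nat \<Rightarrow> nat \<Rightarrow> 'a \<Rightarrow> real"
  assumes "n \<ge> 1" and indep: "indep_vars (\<lambda>_. borel) (\<lambda>(j, k). Z j k) ({1..n} \<times> {1..c})"
  shows "prob {\<omega> \<in> space M. t < max_decode_time n c Z \<omega>} =
    1 - (\<Prod>j=1..n. cdf (distr M borel (decode_time c Z j)) t)"
proof -
  have ind: "indep_vars (\<lambda>_. borel) (decode_time c Z) {1..n}"
    by (rule indep_vars_decode_time) fact
  then have [measurable]: "decode_time c Z j \<in> borel_measurable M" if "j \<in> {1..n}" for j
    using that by (simp add: indep_vars_def)
  have [measurable]: "max_decode_time n c Z \<in> borel_measurable M"
    unfolding max_decode_time_def[abs_def] by measurable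
  have "prob {\<omega> \<in> space M. max_decode_time n c Z \<omega> \<le> t} =
      prob (\<Inter>j\<in>{1..n}. decode_time c Z j -` {..t} \<inter> space M)"
    using \<open>n \<ge> 1\<close> by (intro arg_cong[where f = prob]) (auto simp: max_decode_time_le_iff)
  also have "\<dots> = (\<Prod>j=1..n. prob (decode_time c Z j -` {..t} \<inter> space M))"
    using \<open>n \<ge> 1\<close> by (intro indep_varsD_finite[OF ind]) auto
  also have "\<dots> = (\<Prod>j=1..n. cdf (distr M borel (decode_time c Z j)) t)"
    by (intro prod.cong) (auto simp: cdf_def measure_distr)
  finally show ?thesis
    by (subst not_le[symmetric], subst prob_neg) auto
qed

subsection \<open>The layer-cake formula\<close>

text \<open>\<open>V \<omega>\<close> is the length of \<open>{0..<V \<omega>}\<close>, and Tonelli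
  exchanges the two integrations. A negative value contributes 0 on both sides:
  \<open>ennreal\<close> truncates it and the interval is empty.\<close>

lemma (in sigma_finite_measure) nn_integral_layer_cake:
  fixes V :: "'a \<Rightarrow> real"
  assumes [measurable]: "V \<in> borel_measurable M"
  shows "(\<integral>\<^sup>+\<omega>. ennreal (V \<omega>) \<partial>M) =
    (\<integral>\<^sup>+y. emeasure M {\<omega> \<in> space M. y < V \<omega>} * indicator {0..} y \<partial>lborel)"
proof -
  interpret pair_sigma_finite M lborel ..
  have "(\<integral>\<^sup>+\<omega>. ennreal (V \<omega>) \<partial>M) = (\<integral>\<^sup>+\<omega>. emeasure lborel {0..<V \<omega>} \<partial>M)"
  proof (rule nn_integral_cong)
    show "ennreal (V \<omega>) = emeasure lborel {0..<V \<omega>}" for \<omega>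
      by (cases "0 \<le> V \<omega>") (auto simp: ennreal_neg)
  qed
  \<comment> \<open>The interval is split into two indicators so that, after the exchange, the one
    for \<open>{0..}\<close> is constant in the inner variable and can be pulled out.\<close>
  also have "\<dots> = (\<integral>\<^sup>+\<omega>. \<integral>\<^sup>+y. indicator {0..} y * indicator {..<V \<omega>} y \<partial>lborel \<partial>M)"
  proof (rule nn_integral_cong)
    fix \<omega>
    have "emeasure lborel {0..<V \<omega>} = (\<integral>\<^sup>+y. indicator {0..<V \<omega>} y \<partial>lborel)"
      by (rule nn_integral_indicator[symmetric]) simp
    also have "\<dots> = (\<integral>\<^sup>+y. indicator {0..} y * indicator {..<V \<omega>} y \<partial>lborel)"
      by (intro nn_integral_cong) (auto split: split_indicator)
    finally show "emeasure lborel {0..<V \<omega>} =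
        (\<integral>\<^sup>+y. indicator {0..} y * indicator {..<V \<omega>} y \<partial>lborel)" .
  qed
  also have "\<dots> = (\<integral>\<^sup>+y. \<integral>\<^sup>+\<omega>. indicator {0..} y * indicator {..<V \<omega>} y \<partial>M \<partial>lborel)"
    by (rule Fubini'[symmetric]) (simp add: indicator_def)
  also have "\<dots> = (\<integral>\<^sup>+y. emeasure M {\<omega> \<in> space M. y < V \<omega>} * indicator {0..} y \<partial>lborel)"
  proof (rule nn_integral_cong)
    fix y :: real
    have "(\<integral>\<^sup>+\<omega>. indicator {0..} y * indicator {..<V \<omega>} y \<partial>M) =
        (\<integral>\<^sup>+\<omega>. indicator {0..} y * indicator {\<omega> \<in> space M. y < V \<omega>} \<omega> \<partial>M)"
      by (intro nn_integral_cong) (auto split: split_indicator)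
    also have "\<dots> = indicator {0..} y * emeasure M {\<omega> \<in> space M. y < V \<omega>}"
      by (subst nn_integral_cmult_indicator) auto
    finally show "(\<integral>\<^sup>+\<omega>. indicator {0..} y * indicator {..<V \<omega>} y \<partial>M) =
        emeasure M {\<omega> \<in> space M. y < V \<omega>} * indicator {0..} y"
      by (simp add: mult.commute)
  qed
  finally show ?thesis .
qed

text \<open>Integrability of \<open>V\<close> makes the extended integral finite, which yields both
  the integrability of the tail function and its value; \<open>has_bochner_integral\<close> carries
  the two together.\<close>

lemma (in prob_space) has_bochner_integral_layer_cake:
  fixes V :: "'a \<Rightarrow> real"
  assumes V: "integrable M V" "AE \<omega> in M. 0 \<le> V \<omega>"
  shows "has_bochner_integral lborel
    (\<lambda>y. indicator {0..} y *\<^sub>R prob {\<omega> \<in> space M. y < V \<omega>}) (expectation V)"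
proof (rule has_bochner_integral_nn_integral)
  have [measurable]: "V \<in> borel_measurable M"
    using V by auto
  show "(\<lambda>y. indicator {0..} y *\<^sub>R prob {\<omega> \<in> space M. y < V \<omega>}) \<in> borel_measurable lborel"
    by measurable
  show "0 \<le> expectation V"
    using V by (intro integral_nonneg_AE)
  have "ennreal (expectation V) = (\<integral>\<^sup>+\<omega>. ennreal (V \<omega>) \<partial>M)"
    using V by (intro nn_integral_eq_integral[symmetric])
  also have "\<dots> = (\<integral>\<^sup>+y. ennreal (indicator {0..} y *\<^sub>R prob {\<omega> \<in> space M. y < V \<omega>}) \<partial>lborel)"
    by (subst nn_integral_layer_cake)
       (auto intro!: nn_integral_cong simp: emeasure_eq_measure split: split_indicator)
  finally show "(\<integral>\<^sup>+y. ennreal (indicator {0..} y *\<^sub>R prob {\<omega> \<in> space M. y < V \<omega>}) \<partial>lborel) =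
    ennreal (expectation V)" ..
qed auto

lemma less_power_iff_powr_less:
  fixes v y :: real
  assumes "s \<ge> 1" "0 \<le> v" "0 \<le> y"
  shows "y < v ^ s \<longleftrightarrow> y powr (1 / real s) < v"
proof -
  have "(y powr (1 / real s)) ^ s = y"
    \<comment> \<open>The point \<open>y = 0\<close> is split off: there
      \<open>0 powr (1 / real s) = 0\<close>, and \<open>0 ^ s = 0\<close> because
      \<open>s \<ge> 1\<close>.\<close>
    using assms by (cases "y = 0") (auto simp: powr_power)
  then show ?thesis
    using power_mono_iff[of v "y powr (1 / real s)" s] assms by (simp add: not_le[symmetric])
qed

subsection \<open>The moment bounds\<close>

text \<open>Strictness at both ends makes the rate \<open>\<phi>\<close> of the matching exponential
  variable well defined and positive. It holds because \<open>d\<close> is raised to a negative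
  power, leaving both factors strictly between 0 and 1.\<close>

lemma rlc_prob_in_unit:
  assumes "d \<ge> 2" "k \<in> {1..c}" "0 < q j" "q j < 1"
  shows "0 < rlc_prob d c q j k" "rlc_prob d c q j k < 1"
proof -
  define x where "x = real d powi (int k - 1 - int c)"
  \<comment> \<open>Since \<open>k \<le> c\<close>, the natural subtraction \<open>c + 1 - k\<close>
    does not truncate and is at least 1.\<close>
  have "x = inverse (real d ^ (c + 1 - k))"
    using assms unfolding x_def by (auto simp: power_int_def nat_diff_distrib' Suc_diff_le power_inverse)
  moreover have "1 < real d ^ (c + 1 - k)"
    using assms by (intro one_less_power) auto
  ultimately have x: "0 < x" "x < 1"
    using assms(1) by (auto simp: inverse_less_1_iff)
  then have "0 < (1 - x) * q j" "(1 - x) * q j < 1 * q j"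
    using assms by (auto intro!: mult_strict_right_mono simp del: mult_1)
  then show "0 < rlc_prob d c q j k" "rlc_prob d c q j k < 1"
    unfolding rlc_prob_def x_def[symmetric] using assms(4) by linarith+
qed

text \<open>A Bochner integral defaults to 0 when the function is not integrable, so integrability
  is asserted along with the bounds and the formula. \<open>M\<close> and \<open>N\<close> are
  unrelated spaces; the comparison passes through laws only.\<close>

theorem proposition6:
  fixes M :: "'a measure" and N :: "'b measure"
    and X :: "nat \<Rightarrow> nat \<Rightarrow> 'a \<Rightarrow> nat" and Z :: "nat \<Rightarrow> nat \<Rightarrow> 'b \<Rightarrow> real"
    and n c r d :: nat and q :: "nat \<Rightarrow> real"
  assumes "n \<ge> 1" and "c \<ge> 1" and "r \<ge> 1" and "d \<ge> 2"
    and "\<And>j. j \<in> {1..n} \<Longrightarrow> 0 < q j \<and> q j < 1"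
    and "prob_space M"
    and "prob_space.indep_vars M (\<lambda>_. count_space UNIV) (\<lambda>(j, k). X j k) ({1..n} \<times> {1..c})"
    and "\<And>j k. j \<in> {1..n} \<Longrightarrow> k \<in> {1..c} \<Longrightarrow>
           distr M (count_space UNIV) (X j k) = measure_pmf (Geo (rlc_prob d c q j k))"
    and "prob_space N"
    and "prob_space.indep_vars N (\<lambda>_. borel) (\<lambda>(j, k). Z j k) ({1..n} \<times> {1..c})"
    and "\<And>j k. j \<in> {1..n} \<Longrightarrow> k \<in> {1..c} \<Longrightarrow>
           distributed N lborel (Z j k) (exponential_density (\<phi> (rlc_prob d c q j k)))"
  shows "integrable M (\<lambda>\<omega>. real (max_decode_time n c X \<omega>) ^ r)
    \<and> (\<forall>s. integrable N (\<lambda>\<omega>. max_decode_time n c Z \<omega> ^ s))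
    \<and> \<Psi> N n c Z r \<le> prob_space.expectation M (\<lambda>\<omega>. real (max_decode_time n c X \<omega>) ^ r)
    \<and> prob_space.expectation M (\<lambda>\<omega>. real (max_decode_time n c X \<omega>) ^ r)
        \<le> (\<Sum>s=0..r. real (r choose s) * \<Psi> N n c Z s * real c ^ (r - s))
    \<and> \<Psi> N n c Z 0 = 1
    \<and> (\<forall>s\<ge>1. set_integrable lborel {0..}
            (\<lambda>y. 1 - (\<Prod>j=1..n. cdf (distr N borel (decode_time c Z j)) (y powr (1 / real s))))
        \<and> \<Psi> N n c Z s = (LBINT y:{0..}.
            1 - (\<Prod>j=1..n. cdf (distr N borel (decode_time c Z j)) (y powr (1 / real s)))))"
proof -
  interpret M: prob_space M by fact
  interpret N: prob_space N by fact
  let ?I = "{1..n} \<times> {1..c}"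
  let ?V = "max_decode_time n c Z"
  \<comment> \<open>\<open>W\<close> is a copy of the geometric family living on \<open>N\<close>,
    and \<open>R\<close> is its maximum, cast to the reals to be compared with
    \<open>?V\<close>.\<close>
  define W where "W = (\<lambda>j k \<omega>. nat \<lceil>Z j k \<omega>\<rceil>)"
  define R where "R = (\<lambda>\<omega>. real (max_decode_time n c W \<omega>))"
  have p: "0 < rlc_prob d c q j k" "rlc_prob d c q j k < 1" if "j \<in> {1..n}" "k \<in> {1..c}" for j k
    using rlc_prob_in_unit[of d k c q j] assms(4,5) that by auto
  have rate: "0 < \<phi> (rlc_prob d c q j k)" if "j \<in> {1..n}" "k \<in> {1..c}" for j k
    using p[OF that] by (simp add: \<phi>_def)
  have Z_meas [measurable]: "Z j k \<in> borel_measurable N" if "j \<in> {1..n}" "k \<in> {1..c}" for j k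
    using distributed_measurable[OF assms(11)[OF that]] by simp
  have V_meas [measurable]: "?V \<in> borel_measurable N"
    unfolding max_decode_time_def[abs_def] decode_time_def by measurable

  \<comment> \<open>The exponential density vanishes on the negative reals, which gives
    nonnegativity only almost everywhere; the later comparisons of \<open>?V\<close> and
    \<open>R\<close> inherit this.\<close>
  have "AE \<omega> in N. \<forall>i\<in>?I. 0 \<le> (case i of (j, k) \<Rightarrow> Z j k) \<omega>"
  proof (rule AE_finite_allI)
    fix i assume "i \<in> ?I"
    then obtain j k where i: "i = (j, k)" "j \<in> {1..n}" "k \<in> {1..c}" by auto
    show "AE \<omega> in N. 0 \<le> (case i of (j, k) \<Rightarrow> Z j k) \<omega>"
      using N.distributed_AE2[OF assms(11)[OF i(2,3)], of "\<lambda>x. 0 \<le> x"] i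
      by (simp add: exponential_density_def)
  qed simp
  then have Z_nonneg: "AE \<omega> in N. \<forall>j\<in>{1..n}. \<forall>k\<in>{1..c}. 0 \<le> Z j k \<omega>"
    by eventually_elim auto

  have V_integrable: "integrable N (\<lambda>\<omega>. ?V \<omega> ^ s)" for s
  proof (rule Bochner_Integration.integrable_bound)
    \<comment> \<open>An exponential law is the Erlang law with index 0, and Erlang laws have finite
      moments of every order.\<close>
    show "integrable N (\<lambda>\<omega>. real c ^ s * (\<Sum>(j, k)\<in>?I. Z j k \<omega> ^ s))"
      using N.erlang_ith_moment_integrable[OF rate assms(11)]
      by (auto simp: case_prod_unfold intro!: Bochner_Integration.integrable_sum)
    show "AE \<omega> in N. norm (?V \<omega> ^ s) \<le> norm (real c ^ s * (\<Sum>(j, k)\<in>?I. Z j k \<omega> ^ s))"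
      using Z_nonneg
    proof eventually_elim
      case (elim \<omega>)
      then have "0 \<le> ?V \<omega> ^ s" "?V \<omega> ^ s \<le> real c ^ s * (\<Sum>(j, k)\<in>?I. Z j k \<omega> ^ s)"
        using assms(1,2) max_decode_time_nonneg[of n c Z] max_decode_time_power_le[of n c Z]
        by auto
      then show ?case by simp
    qed
  qed measurable

  have bounds: "AE \<omega> in N. 0 \<le> ?V \<omega> \<and> ?V \<omega> \<le> R \<omega> \<and> R \<omega> \<le> ?V \<omega> + real c"
    using Z_nonneg
  proof eventually_elim
    case (elim \<omega>)
    \<comment> \<open>Nonnegativity matters here because \<open>nat\<close> cuts off at 0: for
      \<open>z < -1\<close> the rounded value 0 would exceed \<open>z + 1\<close>.\<close>
    have "real (W j k \<omega>) \<le> Z j k \<omega> + 1" if "j \<in> {1..n}" "k \<in> {1..c}" for j k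
      using elim that unfolding W_def by auto
    moreover have "Z j k \<omega> \<le> real (W j k \<omega>)" for j k
      unfolding W_def by (rule real_nat_ceiling_ge)
    ultimately show ?case
      using assms(1) elim max_decode_time_nonneg[of n c Z]
        max_decode_time_mono[of n c Z \<omega> "\<lambda>j k \<omega>. real (W j k \<omega>)" 0]
        max_decode_time_mono[of n c "\<lambda>j k \<omega>. real (W j k \<omega>)" \<omega> Z 1]
      by (simp add: R_def real_max_decode_time)
  qed

  have W_indep: "N.indep_vars (\<lambda>_. count_space UNIV) (\<lambda>(j, k). W j k) ?I"
    using N.indep_vars_compose2[OF assms(10), of "\<lambda>_ z. nat \<lceil>z\<rceil>" "\<lambda>_. count_space UNIV"]
    by (simp add: W_def case_prod_unfold)
  have W_distr: "distr N (count_space UNIV) (W j k) = measure_pmf (Geo (rlc_prob d c q j k))"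
    if "j \<in> {1..n}" "k \<in> {1..c}" for j k
    unfolding W_def using N.distr_ceiling_exponential[OF assms(11)] p that by simp

  \<comment> \<open>\<open>P\<close> is the common law of the tuples built from \<open>X\<close> and
    from \<open>W\<close>. The map \<open>h\<close> treats the tuple itself as the sample point,
    with coordinate projections as variables, so both maxima are the same function \<open>h\<close>
    of their tuples.\<close>
  define P where "P = PiM ?I (\<lambda>(j, k). measure_pmf (Geo (rlc_prob d c q j k)))"
  define h where "h = (\<lambda>x. real (max_decode_time n c (\<lambda>j k x. x (j, k)) (x :: nat \<times> nat \<Rightarrow> nat)))"
  let ?C = "count_space (?I \<rightarrow>\<^sub>E (UNIV :: nat set))"
  let ?X = "\<lambda>\<omega>. \<lambda>i\<in>?I. (case i of (j, k) \<Rightarrow> X j k) \<omega>"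
  let ?W = "\<lambda>\<omega>. \<lambda>i\<in>?I. (case i of (j, k) \<Rightarrow> W j k) \<omega>"
  have ne: "finite ?I" "?I \<noteq> {}"
    using assms(1,2) by auto
  have P_X: "distr M ?C ?X = P" and P_W: "distr N ?C ?W = P"
    unfolding P_def using ne assms(6-9) W_indep W_distr
    by (intro distr_joint_eq_PiM; auto)+
  have X_meas: "?X \<in> M \<rightarrow>\<^sub>M ?C"
  proof -
    have "?X \<in> M \<rightarrow>\<^sub>M PiM ?I (\<lambda>_. count_space (UNIV :: nat set))"
      using assms(7) by (intro measurable_restrict) (auto simp: M.indep_vars_def)
    then show ?thesis
      using ne(1) by (simp add: count_space_PiM_finite)
  qed
  have W_meas: "?W \<in> N \<rightarrow>\<^sub>M ?C"
  proof -
    have "?W \<in> N \<rightarrow>\<^sub>M PiM ?I (\<lambda>_. count_space (UNIV :: nat set))"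
      using W_indep by (intro measurable_restrict) (auto simp: N.indep_vars_def)
    then show ?thesis
      using ne(1) by (simp add: count_space_PiM_finite)
  qed
  \<comment> \<open>Restricting the tuple to \<open>?I\<close> loses nothing, since the maximum
    reads only indices in \<open>?I\<close>.\<close>
  have h_X: "h (?X \<omega>) = real (max_decode_time n c X \<omega>)" for \<omega>
    unfolding h_def by (intro arg_cong[where f = real] max_decode_time_cong) auto
  have h_W: "h (?W \<omega>) = R \<omega>" for \<omega>
    unfolding h_def R_def by (intro arg_cong[where f = real] max_decode_time_cong) auto
  have h_meas: "(\<lambda>x. h x ^ r) \<in> borel_measurable ?C"
    by simp
  have "R \<in> borel_measurable N"
    using measurable_compose[OF W_meas, of h borel] by (simp only: h_W) simp
  then have R_meas [measurable]: "(\<lambda>\<omega>. R \<omega> ^ r) \<in> borel_measurable N"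
    by simp

  have binomial: "(?V \<omega> + real c) ^ r =
      (\<Sum>s=0..r. real (r choose s) * ?V \<omega> ^ s * real c ^ (r - s))" for \<omega>
    by (simp add: binomial_ring atLeast0AtMost)
  have sum_integrable: "integrable N (\<lambda>\<omega>. (?V \<omega> + real c) ^ r)"
    unfolding binomial using V_integrable by (intro Bochner_Integration.integrable_sum) auto
  have R_integrable: "integrable N (\<lambda>\<omega>. R \<omega> ^ r)"
  proof (rule Bochner_Integration.integrable_bound[OF sum_integrable])
    show "AE \<omega> in N. norm (R \<omega> ^ r) \<le> norm ((?V \<omega> + real c) ^ r)"
      using bounds by eventually_elim (auto intro!: power_mono)
  qed measurable
  have lower: "N.expectation (\<lambda>\<omega>. ?V \<omega> ^ r) \<le> N.expectation (\<lambda>\<omega>. R \<omega> ^ r)"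
  proof (rule integral_mono_AE[OF V_integrable R_integrable])
    show "AE \<omega> in N. ?V \<omega> ^ r \<le> R \<omega> ^ r"
      using bounds by eventually_elim (auto intro!: power_mono)
  qed
  have "N.expectation (\<lambda>\<omega>. R \<omega> ^ r) \<le> N.expectation (\<lambda>\<omega>. (?V \<omega> + real c) ^ r)"
  proof (rule integral_mono_AE[OF R_integrable sum_integrable])
    show "AE \<omega> in N. R \<omega> ^ r \<le> (?V \<omega> + real c) ^ r"
      using bounds by eventually_elim (auto intro!: power_mono)
  qed
  also have "\<dots> = (\<Sum>s=0..r. real (r choose s) * \<Psi> N n c Z s * real c ^ (r - s))"
    unfolding binomial \<Psi>_def using V_integrable by (subst Bochner_Integration.integral_sum) auto
  finally have upper: "N.expectation (\<lambda>\<omega>. R \<omega> ^ r) \<le>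
    (\<Sum>s=0..r. real (r choose s) * \<Psi> N n c Z s * real c ^ (r - s))" .

  \<comment> \<open>Both sides are integrals of \<open>h ^ r\<close> against \<open>P\<close>, so
    integrability, and then the expectation, moves from \<open>N\<close> to
    \<open>M\<close>.\<close>
  have X_integrable: "integrable M (\<lambda>\<omega>. real (max_decode_time n c X \<omega>) ^ r)"
    using R_integrable integrable_distr_eq[OF X_meas h_meas] integrable_distr_eq[OF W_meas h_meas]
    by (simp only: P_X P_W h_X h_W)
  have X_expectation:
    "M.expectation (\<lambda>\<omega>. real (max_decode_time n c X \<omega>) ^ r) = N.expectation (\<lambda>\<omega>. R \<omega> ^ r)"
    using integral_distr[OF X_meas h_meas] integral_distr[OF W_meas h_meas]
    by (simp only: P_X P_W h_X h_W)

  have tail: "has_bochner_integral lborel (\<lambda>y. indicator {0..} y *\<^sub>R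
      (1 - (\<Prod>j=1..n. cdf (distr N borel (decode_time c Z j)) (y powr (1 / real s))))) (\<Psi> N n c Z s)"
    if s: "s \<ge> 1" for s
  proof -
    have eq: "N.prob {\<omega> \<in> space N. y < ?V \<omega> ^ s} =
        1 - (\<Prod>j=1..n. cdf (distr N borel (decode_time c Z j)) (y powr (1 / real s)))"
      if y: "0 \<le> y" for y
    proof -
      have "N.prob {\<omega> \<in> space N. y < ?V \<omega> ^ s} =
          N.prob {\<omega> \<in> space N. y powr (1 / real s) < ?V \<omega>}"
      \<comment> \<open>Taking the \<open>s\<close>-th root of \<open>y < ?V \<omega> ^ s\<close> is
        legitimate only where \<open>?V \<omega> \<ge> 0\<close>, so the two events agree almost
        everywhere.\<close>
      proof (rule N.finite_measure_eq_AE)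
        show "AE \<omega> in N. \<omega> \<in> {\<omega> \<in> space N. y < ?V \<omega> ^ s} \<longleftrightarrow>
            \<omega> \<in> {\<omega> \<in> space N. y powr (1 / real s) < ?V \<omega>}"
          using bounds by eventually_elim (use s y less_power_iff_powr_less in auto)
      qed measurable
      then show ?thesis
        using N.prob_max_decode_time_gt[OF assms(1,10)] by simp
    qed
    have "has_bochner_integral lborel
        (\<lambda>y. indicator {0..} y *\<^sub>R N.prob {\<omega> \<in> space N. y < ?V \<omega> ^ s}) (\<Psi> N n c Z s)"
      unfolding \<Psi>_def using bounds
      by (intro N.has_bochner_integral_layer_cake V_integrable) (auto elim!: eventually_mono)
    then show ?thesis
      \<comment> \<open>For \<open>y < 0\<close> the indicator annihilates both integrands, so
        \<open>eq\<close> on \<open>0 \<le> y\<close> is enough.\<close>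
      by (rule has_bochner_integral_cong[THEN iffD1, rotated -1])
         (auto simp: eq split: split_indicator)
  qed
  \<comment> \<open>The value \<open>\<Psi> N n c Z 0 = 1\<close> is the total mass of
    \<open>N\<close>, as \<open>?V \<omega> ^ 0 = 1\<close> everywhere.\<close>
  show ?thesis
    using X_integrable V_integrable lower upper tail unfolding X_expectation
    by (auto simp: \<Psi>_def N.prob_space set_integrable_def set_lebesgue_integral_def
        has_bochner_integral_iff)
qed

end
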